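(* Let $X$ be an infinite dimensional complex Banach space and let $T \in L(X)$ be such that $0 \in \sigma_{lw}(T)$. Suppose that $T$ admits a generalized Kato decomposition and that $H_0(T)$ is closed. Then $$0 \in \mathrm{iso}\, \sigma_{lw}(T) \Longleftrightarrow 0 \in \mathrm{iso}\, \sigma(T).$$
   Context: $L(X)$ is the algebra of bounded linear operators on $X$, $\sigma(T)$ is the spectrum of $T$, and for $F\subset\mathbb{C}$, $\mathrm{iso}\,F$ is the set of isolated points of $F$. For a bounded operator $S$ on a complex Banach space, $N(S)$ and $R(S)$ are the null space and range, $\alpha(S)=\dim N(S)$, $\beta(S)=\mathrm{codim}\,R(S)$. $S$ is lower semi-Fredholm if $R(S)$ is closed and $\beta(S)<\infty$, and then $\mathrm{ind}(S)=\alpha(S)-\beta(S)$. $S$ is lower semi-Weyl if it is lower semi-Fredholm with $\mathrm{ind}(S)\ge 0$. $\sigma_{lw}(T)=\{\lambda\in\mathbb{C}: T-\lambda I \text{ is not lower semi-Weyl}\}$. $S$ is Kato if $R(S)$ is closed and $N(S)\subset R(S^n)$ for all integers $n\ge 0$. $S$ is quasinilpotent if $\lim_n \|S^n\|^{1/n}=0$. $T$ admits a generalized Kato decomposition if there exist closed subspaces $M,N$ of $X$ (possibly $\{0\}$) with $T(M)\subset M$, $T(N)\subset N$, $X=M\oplus N$, such that the restriction of $T$ to $M$ (as an operator $M\to M$) is Kato and the restriction of $T$ to $N$ (as an operator $N\to N$) is quasinilpotent. The quasinilpotent part of $T$ is $H_0(T)=\{x\in X: \lim_{n\to\infty}\|T^nx\|^{1/n}=0\}$.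 *)

theory Defs
  imports "HOL-Analysis.Analysis"
begin

text \<open>
  A complex Banach space is a real one together with a scalar multiplication by complex numbers
  that extends the real one and is compatible with the norm.
\<close>

class complex_banach = banach +
  fixes scaleC :: "complex \<Rightarrow> 'a \<Rightarrow> 'a"  (infixr \<open>*\<^sub>C\<close> 75)
  assumes scaleC_add_right: "a *\<^sub>C (x + y) = a *\<^sub>C x + a *\<^sub>C y"
    and scaleC_add_left: "(a + b) *\<^sub>C x = a *\<^sub>C x + b *\<^sub>C x"
    and scaleC_scaleC: "a *\<^sub>C b *\<^sub>C x = (a * b) *\<^sub>C x"
    and scaleR_scaleC: "r *\<^sub>R x = complex_of_real r *\<^sub>C x"
    and norm_scaleC: "norm (a *\<^sub>C x) = cmod a * norm x"

lemma scaleC_one: "1 *\<^sub>C x = (x :: 'a :: complex_banach)"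
  using scaleR_scaleC[of 1 x] by simp

interpretation complex_vector:
  vector_space "scaleC :: complex \<Rightarrow> 'a \<Rightarrow> 'a :: complex_banach"
  by standard (simp_all add: scaleC_add_right scaleC_add_left scaleC_scaleC scaleC_one)

abbreviation csubspace :: "'a::complex_banach set \<Rightarrow> bool"
  where "csubspace \<equiv> complex_vector.subspace"

abbreviation cspan :: "'a::complex_banach set \<Rightarrow> 'a set"
  where "cspan \<equiv> complex_vector.span"

definition bounded_clinear :: "('a::complex_banach \<Rightarrow> 'a) \<Rightarrow> bool"
  where "bounded_clinear T \<longleftrightarrow> bounded_linear T \<and> (\<forall>c x. T (c *\<^sub>C x) = c *\<^sub>C T x)"

definition fin_dim :: "'a::complex_banach set \<Rightarrow> bool"
  where "fin_dim V \<longleftrightarrow> (\<exists>B. finite B \<and> V \<subseteq> cspan B)"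

text \<open>The library function \<open>dim\<close> is \<open>0\<close> on infinite dimensional spaces.\<close>

definition edim :: "'a::complex_banach set \<Rightarrow> enat"
  where "edim V = (if fin_dim V then enat (complex_vector.dim V) else \<infinity>)"

definition direct_sum_decomp :: "'a::complex_banach set \<Rightarrow> 'a set \<Rightarrow> bool"
  where "direct_sum_decomp M N \<longleftrightarrow>
    csubspace M \<and> csubspace N \<and> M \<inter> N = {0} \<and> (\<forall>x. \<exists>m\<in>M. \<exists>n\<in>N. x = m + n)"

text \<open>
  The codimension of a subspace is the dimension of an algebraic complement; by \<open>ecodim_eq\<close>
  below it does not depend on the complement chosen.
\<close>

definition ecodim :: "'a::complex_banach set \<Rightarrow> enat"
  where "ecodim V = edim (SOME W. direct_sum_decomp V W)"

lemma edim_complement_le: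
  fixes V :: "'a::complex_banach set"
  assumes W: "direct_sum_decomp V W" and W': "direct_sum_decomp V W'"
  shows "edim W' \<le> edim W"
proof (cases "fin_dim W")
  case False
  then show ?thesis by (simp add: edim_def)
next
  case True
  obtain B where B: "B \<subseteq> W" "complex_vector.independent B" "W \<subseteq> cspan B"
      "card B = complex_vector.dim W"
    using complex_vector.basis_exists by blast
  from True obtain C where C: "finite C" "W \<subseteq> cspan C"
    by (auto simp: fin_dim_def)
  have finB: "finite B"
    using complex_vector.independent_span_bound[OF C(1) B(2)] B(1) C(2) by blast
  have V: "csubspace V" and sW': "csubspace W'" and i': "V \<inter> W' = {0}"
    using W' by (auto simp: direct_sum_decomp_def)
  have "\<forall>b. \<exists>w\<in>W'. b - w \<in> V"
  proof
    fix b
    obtain m n where "m \<in> V" "n \<in> W'" "b = m + n"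
      using W' unfolding direct_sum_decomp_def by blast
    then show "\<exists>w\<in>W'. b - w \<in> V" by (intro bexI[of _ n]) auto
  qed
  then obtain p where p: "\<And>b. p b \<in> W'" "\<And>b. b - p b \<in> V" by metis
  have sub: "W' \<subseteq> cspan (p ` B)"
  proof
    fix w' assume w': "w' \<in> W'"
    obtain v w where vw: "v \<in> V" "w \<in> W" "w' = v + w"
      using W unfolding direct_sum_decomp_def by blast
    obtain c where c: "w = (\<Sum>b\<in>B. c b *\<^sub>C b)"
      using complex_vector.span_finite[OF finB] vw(2) B(3) by blast
    let ?s = "\<Sum>b\<in>B. c b *\<^sub>C p b"
    have "w' - ?s = v + (\<Sum>b\<in>B. c b *\<^sub>C (b - p b))"
      by (simp add: vw c complex_vector.scale_right_diff_distrib sum_subtractf)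
    also have "\<dots> \<in> V"
      by (intro complex_vector.subspace_add[OF V] complex_vector.subspace_sum[OF V]
          complex_vector.subspace_scale[OF V] vw p)
    finally have "w' - ?s \<in> V" .
    moreover have "w' - ?s \<in> W'"
      by (intro complex_vector.subspace_diff[OF sW'] complex_vector.subspace_sum[OF sW']
          complex_vector.subspace_scale[OF sW'] w' p)
    ultimately have "w' - ?s \<in> {0}" unfolding i'[symmetric] by (rule IntI)
    then have "w' = ?s" by (simp only: singleton_iff right_minus_eq)
    also have "\<dots> \<in> cspan (p ` B)"
      by (intro complex_vector.span_sum complex_vector.span_scale complex_vector.span_base) auto
    finally show "w' \<in> cspan (p ` B)" .
  qed
  have "complex_vector.dim W' \<le> card (p ` B)"
    using complex_vector.dim_le_card[OF sub] finB by simp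
  also have "\<dots> \<le> complex_vector.dim W" unfolding B(4)[symmetric] by (rule card_image_le[OF finB])
  finally have "complex_vector.dim W' \<le> complex_vector.dim W" .
  moreover have "fin_dim W'" using sub finB by (auto simp: fin_dim_def)
  ultimately show ?thesis using True by (simp add: edim_def)
qed

lemma ecodim_eq:
  assumes "direct_sum_decomp V W"
  shows "ecodim V = edim W"
proof -
  have "direct_sum_decomp V (SOME W. direct_sum_decomp V W)"
    using assms by (rule someI)
  then show ?thesis
    unfolding ecodim_def using assms by (intro antisym edim_complement_le)
qed

abbreviation shift :: "('a::complex_banach \<Rightarrow> 'a) \<Rightarrow> complex \<Rightarrow> 'a \<Rightarrow> 'a"
  where "shift T l \<equiv> (\<lambda>x. T x - l *\<^sub>C x)"

definition null_space :: "('a::complex_banach \<Rightarrow> 'a) \<Rightarrow> 'a set"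
  where "null_space S = {x. S x = 0}"

definition nullity :: "('a::complex_banach \<Rightarrow> 'a) \<Rightarrow> enat"
  where "nullity S = edim (null_space S)"

definition deficiency :: "('a::complex_banach \<Rightarrow> 'a) \<Rightarrow> enat"
  where "deficiency S = ecodim (range S)"

definition lower_semi_Fredholm :: "('a::complex_banach \<Rightarrow> 'a) \<Rightarrow> bool"
  where "lower_semi_Fredholm S \<longleftrightarrow> closed (range S) \<and> deficiency S < \<infinity>"

text \<open>
  The index of a lower semi-Fredholm operator lies in the integers extended by \<open>\<infinity>\<close>; it is only
  used for operators of finite deficiency, where the subtraction is unproblematic.
\<close>

definition op_index :: "('a::complex_banach \<Rightarrow> 'a) \<Rightarrow> ereal"
  where "op_index S = ereal_of_enat (nullity S) - ereal_of_enat (deficiency S)"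

definition lower_semi_Weyl :: "('a::complex_banach \<Rightarrow> 'a) \<Rightarrow> bool"
  where "lower_semi_Weyl S \<longleftrightarrow> lower_semi_Fredholm S \<and> op_index S \<ge> 0"

definition lw_spectrum :: "('a::complex_banach \<Rightarrow> 'a) \<Rightarrow> complex set"
  where "lw_spectrum T = {l. \<not> lower_semi_Weyl (shift T l)}"

definition invertible_op :: "('a::complex_banach \<Rightarrow> 'a) \<Rightarrow> bool"
  where "invertible_op S \<longleftrightarrow> (\<exists>R. bounded_clinear R \<and> R \<circ> S = id \<and> S \<circ> R = id)"

definition spectrum :: "('a::complex_banach \<Rightarrow> 'a) \<Rightarrow> complex set"
  where "spectrum T = {l. \<not> invertible_op (shift T l)}"

text \<open>
  The restriction of \<open>T\<close> to a closed invariant subspace \<open>M\<close> is represented by the pair of \<open>M\<close>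
  and \<open>T\<close>. As \<open>M\<close> is closed, a subset of \<open>M\<close> is closed in \<open>M\<close> iff it is closed in the whole space.
\<close>

definition Kato_on :: "'a::complex_banach set \<Rightarrow> ('a \<Rightarrow> 'a) \<Rightarrow> bool"
  where "Kato_on M T \<longleftrightarrow>
    closed (T ` M) \<and> (\<forall>n::nat. {x \<in> M. T x = 0} \<subseteq> (T ^^ n) ` M)"

text \<open>The operator norm of the restriction, in the form of \<open>onorm\<close>; it is \<open>0\<close> if \<open>M = {0}\<close>.\<close>

definition onorm_on :: "'a::complex_banach set \<Rightarrow> ('a \<Rightarrow> 'a) \<Rightarrow> real"
  where "onorm_on M T = (SUP x\<in>M. norm (T x) / norm x)"

definition quasinilpotent_on :: "'a::complex_banach set \<Rightarrow> ('a \<Rightarrow> 'a) \<Rightarrow> bool"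
  where "quasinilpotent_on M T \<longleftrightarrow> (\<lambda>n. root n (onorm_on M (T ^^ n))) \<longlonglongrightarrow> 0"

definition admits_GKD :: "('a::complex_banach \<Rightarrow> 'a) \<Rightarrow> bool"
  where "admits_GKD T \<longleftrightarrow> (\<exists>M N. closed M \<and> closed N \<and> direct_sum_decomp M N \<and>
    T ` M \<subseteq> M \<and> T ` N \<subseteq> N \<and> Kato_on M T \<and> quasinilpotent_on N T)"

definition quasinilpotent_part :: "('a::complex_banach \<Rightarrow> 'a) \<Rightarrow> 'a set"
  where "quasinilpotent_part T = {x. (\<lambda>n. root n (norm ((T ^^ n) x))) \<longlonglongrightarrow> 0}"

end

theory Submission
  imports Defs
begin

text \<open>
  An invertible operator is lower semi-Weyl, so \<open>lw_spectrum T \<subseteq> spectrum T\<close>, and a point of the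
  smaller set that is isolated in the larger one is isolated in the smaller one.

  For the converse it suffices that \<open>T - l\<close> is injective for all small \<open>l \<noteq> 0\<close>: an injective
  operator has nullity \<open>0\<close>, so nonnegative index forces deficiency \<open>0\<close>. An injective lower semi-Weyl
  operator is therefore bijective, and its inverse is bounded by the open mapping theorem.

  Let \<open>M\<close> and \<open>N\<close> be the Kato and the quasinilpotent summand of a generalized Kato decomposition. As
  \<open>M\<close> and \<open>N\<close> are invariant and independent, both components of an eigenvector of \<open>T\<close> satisfy the
  same eigenvalue equation, so the two summands can be treated separately. On \<open>N\<close> there is no nonzero
  eigenvalue, because \<open>N\<close> lies in the quasinilpotent part \<open>H\<close> of \<open>T\<close>, and an eigenvector for \<open>l\<close>
  has local spectral radius \<open>\<bar>l\<bar>\<close>.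

  On \<open>M\<close> the closedness of \<open>H\<close> comes in: it makes \<open>T\<close> injective there
  (\<open>Kato_closed_quasinilpotent_part_imp_injective\<close>). Indeed, every \<open>x \<in> M\<close> in the kernel of \<open>T\<close>
  starts an infinite chain of preimages \<open>u\<^sub>0 = x\<close>, \<open>T u\<^sub>n\<^sub>+\<^sub>1 = u\<^sub>n\<close> of at most geometric growth. For
  small \<open>t\<close> the vector \<open>\<Sum>n. t\<^sup>n u\<^sub>n\<close> satisfies the eigenvalue equation for \<open>t\<close> and is a limit of
  vectors annihilated by a power of \<open>T\<close>; so it lies in \<open>H\<close> and vanishes, and this forces \<open>x = 0\<close>.
  Being injective with closed range, \<open>T\<close> is bounded below on \<open>M\<close> (\<open>bounded_preimage\<close>), and so all
  its eigenvalues there are bounded away from \<open>0\<close>.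
\<close>

section \<open>Bounded preimages under operators with closed range\<close>

text \<open>
  The closures of the images of the balls of integer radius in \<open>M\<close> cover the complete space \<open>f ` M\<close>.
  By Baire's theorem one of them contains a relative ball; differences of its points give
  approximate preimages of all small vectors, and scaling gives them for all vectors.
\<close>

lemma approximate_preimage_bound:
  fixes f :: "'a::real_normed_vector \<Rightarrow> 'b::banach"
  assumes f: "bounded_linear f" and M: "subspace M" and closed: "closed (f ` M)"
  obtains K where "K \<ge> 0"
    "\<And>y e. y \<in> f ` M \<Longrightarrow> e > 0 \<Longrightarrow> \<exists>x\<in>M. norm x \<le> K * norm y \<and> norm (y - f x) < e"
proof -
  interpret f: bounded_linear f by fact
  let ?Y = "f ` M"
  define F where "F n = closure (f ` {x \<in> M. norm x \<le> real n})" for n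
  have Y: "subspace ?Y" by (rule linear_subspace_image[OF f.linear M])
  have FY: "F n \<subseteq> ?Y" for n
    unfolding F_def by (rule closure_minimal) (use closed in auto)
  have cover: "\<Union>(range F) = ?Y"
  proof
    show "\<Union>(range F) \<subseteq> ?Y" using FY by blast
    show "?Y \<subseteq> \<Union>(range F)"
    proof
      fix y assume "y \<in> ?Y"
      then obtain x where x: "x \<in> M" "y = f x" by blast
      obtain n where "norm x \<le> real n" using real_arch_simple by blast
      with x have "y \<in> F n" unfolding F_def by (intro subsetD[OF closure_subset]) auto
      then show "y \<in> \<Union>(range F)" by blast
    qed
  qed
  have "\<exists>n. top_of_set ?Y interior_of F n \<noteq> {}"
  proof (rule ccontr)
    assume "\<nexists>n. top_of_set ?Y interior_of F n \<noteq> {}"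
    then have "top_of_set ?Y interior_of \<Union>(range F) = {}"
    proof (intro Baire_category_alt disjI1)
      show "completely_metrizable_space (top_of_set ?Y)"
        using closed by (intro completely_metrizable_space_closedin
            completely_metrizable_space_euclidean) auto
    next
      fix S assume "S \<in> range F"
      then obtain n where "S = F n" by blast
      moreover have "closedin (top_of_set ?Y) (F n)"
        using FY by (intro closed_subset) (auto simp: F_def)
      ultimately show "closedin (top_of_set ?Y) S \<and> top_of_set ?Y interior_of S = {}"
        using \<open>\<nexists>n. top_of_set ?Y interior_of F n \<noteq> {}\<close> by auto
    qed auto
    moreover have "top_of_set ?Y interior_of ?Y = ?Y"
      using interior_of_topspace[of "top_of_set ?Y"] by simp
    moreover have "0 \<in> ?Y" using Y by (rule subspace_0)
    ultimately show False by (auto simp: cover)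
  qed
  then obtain n y0 U where U: "openin (top_of_set ?Y) U" "y0 \<in> U" "U \<subseteq> F n"
    unfolding interior_of_def by blast
  then have y0: "y0 \<in> ?Y" using openin_subset by fastforce
  obtain r where r: "r > 0" "\<And>z. z \<in> ?Y \<Longrightarrow> dist z y0 < r \<Longrightarrow> z \<in> F n"
    using U unfolding openin_euclidean_subtopology_iff by (metis subsetD)
  have approx: "\<exists>x\<in>M. norm x \<le> real n \<and> norm (z - f x) < d" if "z \<in> F n" "d > 0" for z d
    using that unfolding F_def closure_approachable by (auto simp: dist_norm norm_minus_commute)
  show ?thesis
  proof (rule that[of "4 * real n / r"])
    show "4 * real n / r \<ge> 0" using r(1) by simp
    fix y e assume y: "y \<in> ?Y" and e: "(e::real) > 0"
    show "\<exists>x\<in>M. norm x \<le> 4 * real n / r * norm y \<and> norm (y - f x) < e"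
    proof (cases "y = 0")
      case True
      then show ?thesis using e subspace_0[OF M] by (intro bexI[of _ 0]) (auto simp: f.zero)
    next
      case False
      \<comment> \<open>Dividing by \<open>s\<close> gives \<open>y\<close> the norm \<open>r / 2\<close>, so that adding it to the centre \<open>y0\<close> stays
        inside the ball.\<close>
      define s where "s = 2 * norm y / r"
      have s: "s > 0" using False r(1) by (simp add: s_def)
      have sy: "norm (y /\<^sub>R s) = r / 2" using False r(1) by (simp add: s_def)
      have "y0 + y /\<^sub>R s \<in> F n"
        using r Y y y0 sy by (intro r(2) subspace_add subspace_scale) (auto simp: dist_norm)
      moreover have "y0 \<in> F n" using U by blast
      moreover have d: "e / (2 * s) > 0" using e s by simp
      ultimately obtain x1 x2 where x: "x1 \<in> M" "norm x1 \<le> real n" "x2 \<in> M" "norm x2 \<le> real n"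
        "norm ((y0 + y /\<^sub>R s) - f x1) < e / (2 * s)" "norm (y0 - f x2) < e / (2 * s)"
        using approx by metis
      let ?x = "s *\<^sub>R (x1 - x2)"
      have "y - f ?x = s *\<^sub>R (((y0 + y /\<^sub>R s) - f x1) - (y0 - f x2))"
        using s by (simp add: f.scaleR f.diff algebra_simps)
      also have "norm \<dots> \<le> s * (norm ((y0 + y /\<^sub>R s) - f x1) + norm (y0 - f x2))"
        using s norm_triangle_ineq4[of "(y0 + y /\<^sub>R s) - f x1" "y0 - f x2"]
        by (simp only: norm_scaleR abs_of_pos mult_left_mono less_imp_le)
      also have "\<dots> < s * (e / (2 * s) + e / (2 * s))"
        using s x by (intro mult_strict_left_mono add_strict_mono)
      also have "\<dots> = e" using s by simp
      finally have "norm (y - f ?x) < e" .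
      moreover have "norm ?x \<le> s * (real n + real n)"
        using s x norm_triangle_ineq4[of x1 x2] by simp
      then have "norm ?x \<le> 4 * real n / r * norm y" by (simp add: s_def field_simps)
      ultimately show ?thesis
        using x M by (intro bexI[of _ ?x]) (auto intro: subspace_scale subspace_diff)
    qed
  qed
qed

text \<open>
  The open mapping theorem for the restriction of \<open>f\<close> to \<open>M\<close>, in quantitative form: replacing \<open>y\<close> by
  the error of an approximate preimage halves its norm, and the approximate preimages of the
  successive errors add up to an exact preimage.
\<close>

lemma bounded_preimage:
  fixes f :: "'a::banach \<Rightarrow> 'b::banach"
  assumes f: "bounded_linear f" and M: "subspace M" "closed M" and closed: "closed (f ` M)"
  obtains C where "C > 0" "\<And>y. y \<in> f ` M \<Longrightarrow> \<exists>x\<in>M. f x = y \<and> norm x \<le> C * norm y"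
proof -
  interpret f: bounded_linear f by fact
  let ?Y = "f ` M"
  have Y: "subspace ?Y" by (rule linear_subspace_image[OF f.linear M(1)])
  obtain K where K: "K \<ge> 0"
    "\<And>y e. y \<in> ?Y \<Longrightarrow> e > 0 \<Longrightarrow> \<exists>x\<in>M. norm x \<le> K * norm y \<and> norm (y - f x) < e"
    using approximate_preimage_bound[OF f M(1) closed] by metis
  have "\<exists>x\<in>M. norm x \<le> K * norm y \<and> norm (y - f x) \<le> norm y / 2" if "y \<in> ?Y" for y
  proof (cases "y = 0")
    case True
    then show ?thesis using subspace_0[OF M(1)] by (intro bexI[of _ 0]) (auto simp: f.zero)
  next
    case False
    then show ?thesis using K(2)[OF that, of "norm y / 2"] by fastforce
  qed
  then obtain g where g: "\<And>y. y \<in> ?Y \<Longrightarrow> g y \<in> M" "\<And>y. y \<in> ?Y \<Longrightarrow> norm (g y) \<le> K * norm y"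
    "\<And>y. y \<in> ?Y \<Longrightarrow> norm (y - f (g y)) \<le> norm y / 2"
    by metis
  show ?thesis
  proof (rule that[of "2 * K + 1"])
    show "2 * K + 1 > 0" using K(1) by simp
    fix y assume y: "y \<in> ?Y"
    define u where "u n = ((\<lambda>z. z - f (g z)) ^^ n) y" for n
    have u0: "u 0 = y" and uSuc: "u (Suc n) = u n - f (g (u n))" for n by (simp_all add: u_def)
    have uY: "u n \<in> ?Y" for n
      by (induction n) (use y u0 uSuc g(1) Y in \<open>auto intro: subspace_diff\<close>)
    have un: "norm (u n) \<le> norm y * (1/2) ^ n" for n
    proof (induction n)
      case (Suc n)
      then show ?case using g(3)[OF uY[of n]] by (simp add: uSuc)
    qed (simp add: u0)
    have gn: "norm (g (u n)) \<le> K * norm y * (1/2) ^ n" for n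
      using order_trans[OF g(2)[OF uY] mult_left_mono[OF un K(1)]] by (simp add: mult.assoc)
    have "(\<lambda>n. (1/2::real) ^ n) sums (1 / (1 - 1/2))" by (rule geometric_sums) simp
    then have geo: "(\<lambda>n. K * norm y * (1/2) ^ n) sums (K * norm y * 2)"
      by (intro sums_mult) simp
    have summ: "summable (\<lambda>n. norm (g (u n)))"
      by (rule summable_comparison_test[OF _ sums_summable[OF geo]]) (use gn in auto)
    let ?x = "\<Sum>n. g (u n)"
    have "(\<lambda>n. g (u n)) sums ?x" using summable_norm_cancel[OF summ] by (rule summable_sums)
    then have fx: "(\<lambda>n. f (g (u n))) sums f ?x" by (rule f.sums)
    have "u \<longlonglongrightarrow> 0"
    proof (rule Lim_null_comparison)
      show "\<forall>\<^sub>F n in sequentially. norm (u n) \<le> norm y * (1/2) ^ n" using un by simp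
      show "(\<lambda>n. norm y * (1/2) ^ n) \<longlonglongrightarrow> 0"
        by (intro tendsto_mult_right_zero LIMSEQ_power_zero) simp
    qed
    then have "(\<lambda>n. u n - u (Suc n)) sums (u 0 - 0)" by (rule telescope_sums')
    then have "(\<lambda>n. f (g (u n))) sums y" by (simp add: uSuc u0)
    with fx have "f ?x = y" by (rule sums_unique2)
    moreover have "norm ?x \<le> K * norm y * 2"
      using summable_norm[OF summ] suminf_le[OF gn summ sums_summable[OF geo]] sums_unique[OF geo]
      by simp
    then have "norm ?x \<le> (2 * K + 1) * norm y" by (simp add: algebra_simps add_increasing)
    moreover have "?x \<in> M"
    proof (rule closed_sequentially[OF M(2)])
      show "(\<lambda>n. \<Sum>k<n. g (u k)) \<longlonglongrightarrow> ?x"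
        using summable_norm_cancel[OF summ] by (rule summable_LIMSEQ)
    qed (use g(1) uY M(1) in \<open>auto intro: subspace_sum\<close>)
    ultimately show "\<exists>x\<in>M. f x = y \<and> norm x \<le> (2 * K + 1) * norm y" by blast
  qed
qed

section \<open>Complex linear operators\<close>

lemma csubspace_imp_subspace: "csubspace M \<Longrightarrow> subspace M"
  by (auto simp: complex_vector.subspace_def subspace_def scaleR_scaleC)

lemma bounded_linear_scaleC: "bounded_linear (\<lambda>x::'a::complex_banach. l *\<^sub>C x)"
  by (rule bounded_linear_intro[of _ "cmod l"])
    (simp_all add: scaleC_add_right scaleR_scaleC scaleC_scaleC norm_scaleC mult.commute)

lemma bounded_linear_funpow:
  fixes f :: "'a::real_normed_vector \<Rightarrow> 'a"
  assumes "bounded_linear f"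
  shows "bounded_linear (f ^^ n)"
  using assms by (induction n)
    (auto simp: o_def id_def intro: bounded_linear_compose[of f] bounded_linear_ident)

lemma bounded_clinear_shift:
  assumes "bounded_clinear T"
  shows "bounded_clinear (shift T l)"
  using assms unfolding bounded_clinear_def
  by (auto intro: bounded_linear_sub bounded_linear_scaleC
      simp: complex_vector.scale_right_diff_distrib scaleC_scaleC mult.commute)

lemma csubspace_range:
  assumes "bounded_clinear S"
  shows "csubspace (range S)"
proof -
  interpret bounded_linear S using assms by (simp add: bounded_clinear_def)
  have hom: "\<And>c x. S (c *\<^sub>C x) = c *\<^sub>C S x" using assms by (simp add: bounded_clinear_def)
  have "S 0 = 0" by (rule zero)
  then have "0 \<in> range S" by (metis rangeI)
  then show ?thesis
    unfolding complex_vector.subspace_def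
    by (auto simp: simp flip: add hom)
qed

lemma bij_bounded_clinear_imp_invertible:
  assumes S: "bounded_clinear S" and "bij S"
  shows "invertible_op S"
proof -
  have lin: "bounded_linear S" and hom: "\<And>c x. S (c *\<^sub>C x) = c *\<^sub>C S x"
    using S by (auto simp: bounded_clinear_def)
  interpret S: bounded_linear S by fact
  have inj: "inj S" and surj: "surj S" using \<open>bij S\<close> by (auto simp: bij_def)
  obtain C where "C > 0" and C: "\<And>y. \<exists>x. S x = y \<and> norm x \<le> C * norm y"
    using bounded_preimage[OF lin, of UNIV] surj by auto
  have "bounded_linear (inv S)"
  proof (rule bounded_linear_intro)
    show "inv S (x + y) = inv S x + inv S y" for x y
      using inj surj by (intro inv_f_eq) (simp_all add: S.add surj_f_inv_f)
    show "inv S (r *\<^sub>R x) = r *\<^sub>R inv S x" for r x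
      using inj surj by (intro inv_f_eq) (simp_all add: S.scaleR surj_f_inv_f)
    show "norm (inv S y) \<le> norm y * C" for y
      using C[of y] inj by (metis inv_f_f mult.commute)
  qed
  moreover have "inv S (c *\<^sub>C x) = c *\<^sub>C inv S x" for c x
    using inj surj by (intro inv_f_eq) (simp_all add: hom surj_f_inv_f)
  ultimately show ?thesis
    using inj surj unfolding invertible_op_def bounded_clinear_def
    by (intro exI[of _ "inv S"]) (auto simp: surj_iff)
qed

section \<open>Codimension and Weyl operators\<close>

text \<open>
  The kernel of a linear projection onto \<open>V\<close> is a complement. Without one, the choice operator in
  \<open>ecodim\<close> would say nothing about \<open>V\<close>.
\<close>

lemma complement_exists:
  fixes V :: "'a::complex_banach set"
  assumes "csubspace V"
  obtains W where "direct_sum_decomp V W"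
proof -
  interpret p: vector_space_pair "scaleC :: complex \<Rightarrow> 'a \<Rightarrow> 'a" "scaleC :: complex \<Rightarrow> 'a \<Rightarrow> 'a"
    by unfold_locales
  obtain g where g: "range g \<subseteq> V" "Vector_Spaces.linear scaleC scaleC g" "\<And>v. v \<in> V \<Longrightarrow> g v = v"
    using p.linear_exists_left_inverse_on[OF complex_vector.linear_id assms] by auto
  interpret g: Vector_Spaces.linear scaleC scaleC g by fact
  have "direct_sum_decomp V {x. g x = 0}"
    unfolding direct_sum_decomp_def
  proof (intro conjI allI assms)
    show "csubspace {x. g x = 0}" by (rule g.subspace_kernel)
    show "V \<inter> {x. g x = 0} = {0}" using g(3) complex_vector.subspace_0[OF assms] by force
    fix x
    have "g x \<in> V" using g(1) by auto
    then show "\<exists>m\<in>V. \<exists>n\<in>{x. g x = 0}. x = m + n"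
      using g(3) by (intro bexI[of _ "g x"] bexI[of _ "x - g x"]) (auto simp: g.diff)
  qed
  then show ?thesis by (rule that)
qed

lemma edim_zero: "edim {0::'a::complex_banach} = 0"
proof -
  have "complex_vector.dim {0::'a} = 0"
    using complex_vector.dim_span[of "{}::'a set"] complex_vector.dim_eq_card_independent[of "{}::'a set"]
    by (simp add: complex_vector.independent_empty)
  moreover have "fin_dim {0::'a}" unfolding fin_dim_def by (intro exI[of _ "{}"]) simp
  ultimately show ?thesis by (simp add: edim_def zero_enat_def)
qed

lemma edim_eq_0_imp:
  fixes V :: "'a::complex_banach set"
  assumes "edim V = 0"
  shows "V \<subseteq> {0}"
proof -
  have fin: "fin_dim V" and dim: "complex_vector.dim V = 0"
    using assms by (auto simp: edim_def enat_0_iff split: if_splits)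
  obtain B where B: "B \<subseteq> V" "complex_vector.independent B" "V \<subseteq> cspan B"
      "card B = complex_vector.dim V"
    using complex_vector.basis_exists by blast
  have "finite B"
    using fin complex_vector.independent_span_bound[OF _ B(2)] B(1) by (auto simp: fin_dim_def)
  with B dim show ?thesis by simp
qed

lemma ecodim_eq_0_iff:
  fixes V :: "'a::complex_banach set"
  assumes V: "csubspace V"
  shows "ecodim V = 0 \<longleftrightarrow> V = UNIV"
proof
  obtain W where W: "direct_sum_decomp V W" using complement_exists[OF V] .
  assume "ecodim V = 0"
  then have "W \<subseteq> {0}" using edim_eq_0_imp ecodim_eq[OF W] by metis
  then show "V = UNIV" using W unfolding direct_sum_decomp_def by (auto simp: set_eq_iff) force
next
  assume "V = UNIV"
  then have "direct_sum_decomp V {0}"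
    using V by (auto simp: direct_sum_decomp_def complex_vector.subspace_single_0)
  then show "ecodim V = 0" by (simp add: ecodim_eq edim_zero)
qed

lemma nullity_eq_0_if_inj:
  assumes "bounded_clinear S" "inj S"
  shows "nullity S = 0"
proof -
  interpret bounded_linear S using assms by (simp add: bounded_clinear_def)
  have "null_space S = {0}" using injD[OF assms(2), of _ 0] zero by (auto simp: null_space_def)
  then show ?thesis by (simp add: nullity_def edim_zero)
qed

lemma injective_lower_semi_Weyl_imp_surj:
  assumes S: "bounded_clinear S" and "inj S" and "lower_semi_Weyl S"
  shows "surj S"
proof -
  have "op_index S \<ge> 0" using assms(3) by (simp add: lower_semi_Weyl_def)
  then have "deficiency S = 0"
    using nullity_eq_0_if_inj[OF assms(1,2)]
    by (cases "deficiency S") (auto simp: op_index_def zero_enat_def)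
  then show ?thesis by (simp add: deficiency_def ecodim_eq_0_iff csubspace_range[OF S])
qed

lemma invertible_imp_lower_semi_Weyl:
  assumes S: "bounded_clinear S" and "invertible_op S"
  shows "lower_semi_Weyl S"
proof -
  have "inj S" "surj S"
    using assms(2) o_bij bij_is_inj bij_is_surj unfolding invertible_op_def by blast+
  then have "nullity S = 0" "deficiency S = 0"
    using nullity_eq_0_if_inj[OF S] ecodim_eq_0_iff[OF csubspace_range[OF S]]
    by (auto simp: deficiency_def)
  with \<open>surj S\<close> show ?thesis
    by (simp add: lower_semi_Weyl_def lower_semi_Fredholm_def op_index_def)
qed

section \<open>Eigenvectors and the generalized Kato decomposition\<close>

text \<open>
  For \<open>x \<noteq> 0\<close> the sequence \<open>root n (norm ((T ^^ n) x)) = \<bar>l\<bar> * root n (norm x)\<close> tends to \<open>\<bar>l\<bar>\<close>.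
\<close>

lemma eigenvector_notin_quasinilpotent_part:
  assumes T: "bounded_clinear T" and x: "T x = l *\<^sub>C x" "x \<in> quasinilpotent_part T" and "l \<noteq> 0"
  shows "x = 0"
proof (rule ccontr)
  assume "x \<noteq> 0"
  have pow: "(T ^^ n) x = (l ^ n) *\<^sub>C x" for n
    using T x(1) by (induction n) (simp_all add: scaleC_one bounded_clinear_def scaleC_scaleC mult.commute)
  have "\<forall>\<^sub>F n in sequentially. cmod l * root n (norm x) = root n (norm ((T ^^ n) x))"
    using eventually_gt_at_top[of 0]
    by eventually_elim (simp add: pow norm_scaleC norm_power real_root_mult real_root_power_cancel)
  moreover have "(\<lambda>n. cmod l * root n (norm x)) \<longlonglongrightarrow> cmod l * 1"
    using \<open>x \<noteq> 0\<close> by (intro tendsto_mult tendsto_const LIMSEQ_root_const) simp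
  ultimately have "(\<lambda>n. root n (norm ((T ^^ n) x))) \<longlonglongrightarrow> cmod l"
    using Lim_transform_eventually by simp
  with x(2) have "cmod l = 0"
    unfolding quasinilpotent_part_def by (blast intro: LIMSEQ_unique)
  with \<open>l \<noteq> 0\<close> show False by simp
qed

lemma quasinilpotent_on_imp_subset_quasinilpotent_part:
  assumes T: "bounded_clinear T" and N: "quasinilpotent_on N T"
  shows "N \<subseteq> quasinilpotent_part T"
proof
  interpret T: bounded_linear T using T by (simp add: bounded_clinear_def)
  fix x assume x: "x \<in> N"
  show "x \<in> quasinilpotent_part T"
  proof (cases "x = 0")
    case True
    have "(T ^^ n) 0 = 0" for n by (induction n) (simp_all add: T.zero)
    then show ?thesis by (simp add: True quasinilpotent_part_def)
  next
    case False
    let ?a = "\<lambda>n. onorm_on N (T ^^ n)"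
    have le: "norm ((T ^^ n) x) \<le> ?a n * norm x" for n
    proof -
      obtain B where "\<And>z. norm ((T ^^ n) z) \<le> norm z * B"
        using bounded_linear.bounded[OF bounded_linear_funpow[OF T.bounded_linear_axioms]] by blast
      then have "norm ((T ^^ n) z) / norm z \<le> max B 0" for z
        by (cases "z = 0") (auto simp: divide_le_eq mult.commute le_max_iff_disj)
      then have "bdd_above ((\<lambda>z. norm ((T ^^ n) z) / norm z) ` N)" by (auto intro!: bdd_aboveI)
      then have "norm ((T ^^ n) x) / norm x \<le> ?a n"
        unfolding onorm_on_def using x by (rule cSUP_upper2) simp
      then show ?thesis using False by (simp add: divide_le_eq)
    qed
    have "(\<lambda>n. root n (?a n) * root n (norm x)) \<longlonglongrightarrow> 0 * 1"
      using N False unfolding quasinilpotent_on_def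
      by (intro tendsto_mult LIMSEQ_root_const) auto
    then have "(\<lambda>n. root n (?a n) * root n (norm x)) \<longlonglongrightarrow> 0" by simp
    moreover have "\<forall>\<^sub>F n in sequentially.
        norm (root n (norm ((T ^^ n) x))) \<le> root n (?a n) * root n (norm x)"
      using eventually_gt_at_top[of 0]
    proof eventually_elim
      case (elim n)
      then show ?case
        using real_root_le_mono[OF elim le[of n]] by (simp add: real_root_mult)
    qed
    ultimately show ?thesis
      unfolding quasinilpotent_part_def by (auto intro: Lim_null_comparison)
  qed
qed

text \<open>
  If \<open>y = T\<^sup>n\<^sup>+\<^sup>1 w\<close>, then \<open>z\<close> and \<open>T\<^sup>n w\<close> differ by an element of the kernel, which the Kato condition
  places in the range of \<open>T\<^sup>n\<close>. Hence any preimage of a vector of the hyperrange (the intersection of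
  the ranges of all powers) is again in the hyperrange, so preimages can be iterated without
  restricting their choice.
\<close>

lemma Kato_preimage_in_hyperrange:
  assumes T: "bounded_clinear T" and M: "csubspace M" and inv: "T ` M \<subseteq> M"
    and Kato: "Kato_on M T" and y: "\<And>n. y \<in> (T ^^ n) ` M" and z: "z \<in> M" "T z = y"
  shows "z \<in> (T ^^ n) ` M"
proof -
  interpret T: bounded_linear T using T by (simp add: bounded_clinear_def)
  have pow: "linear (T ^^ n)" for n
    using bounded_linear_funpow[OF T.bounded_linear_axioms] by (rule bounded_linear.linear)
  have powM: "(T ^^ n) w \<in> M" if "w \<in> M" for w
    using that inv by (induction n) auto
  obtain w where w: "w \<in> M" "y = (T ^^ Suc n) w" using y by blast
  have "T (z - (T ^^ n) w) = 0" using w z by (simp add: T.diff)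
  moreover have "z - (T ^^ n) w \<in> M"
    using M z w powM by (intro complex_vector.subspace_diff) auto
  ultimately obtain v where v: "v \<in> M" "z - (T ^^ n) w = (T ^^ n) v"
    using Kato unfolding Kato_on_def by blast
  then have "z = (T ^^ n) (v + w)" using linear_add[OF pow] by (simp add: algebra_simps)
  then show ?thesis using M v w complex_vector.subspace_add by blast
qed

text \<open>
  The kernel is contained in the hyperrange, so \<open>x\<close> starts a chain of preimages, and \<open>bounded_preimage\<close>
  limits its growth. Summing the chain with the weights \<open>t\<^sup>n\<close> gives a vector satisfying the
  eigenvalue equation for \<open>t\<close>.
\<close>

lemma Kato_closed_quasinilpotent_part_imp_injective:
  fixes T :: "'a::complex_banach \<Rightarrow> 'a"
  assumes T: "bounded_clinear T" and M: "csubspace M" "closed M" and inv: "T ` M \<subseteq> M"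
    and Kato: "Kato_on M T" and H: "closed (quasinilpotent_part T)"
    and x: "x \<in> M" "T x = 0"
  shows "x = 0"
proof -
  interpret T: bounded_linear T using T by (simp add: bounded_clinear_def)
  define R where "R = {y. \<forall>n. y \<in> (T ^^ n) ` M}"
  obtain C where C: "C > 0" "\<And>y. y \<in> T ` M \<Longrightarrow> \<exists>z\<in>M. T z = y \<and> norm z \<le> C * norm y"
    using bounded_preimage[OF T.bounded_linear_axioms csubspace_imp_subspace[OF M(1)] M(2)] Kato
    unfolding Kato_on_def by metis
  have "\<exists>z\<in>R. T z = y \<and> norm z \<le> C * norm y" if y: "y \<in> R" for y
  proof -
    have "y \<in> (T ^^ 1) ` M" using y unfolding R_def by blast
    then obtain z where "z \<in> M" "T z = y" "norm z \<le> C * norm y" using C(2) by auto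
    moreover from this have "z \<in> R"
      using Kato_preimage_in_hyperrange[OF T M(1) inv Kato] y unfolding R_def by blast
    ultimately show ?thesis by blast
  qed
  then obtain g where g: "\<And>y. y \<in> R \<Longrightarrow> g y \<in> R" "\<And>y. y \<in> R \<Longrightarrow> T (g y) = y"
      "\<And>y. y \<in> R \<Longrightarrow> norm (g y) \<le> C * norm y"
    by metis
  define u where "u n = (g ^^ n) x" for n
  have u0: "u 0 = x" by (simp add: u_def)
  have uR: "u n \<in> R" for n
  proof (induction n)
    case 0
    then show ?case using x Kato by (auto simp: u_def R_def Kato_on_def)
  next
    case (Suc n)
    then show ?case using g(1) by (simp add: u_def)
  qed
  have Tu: "T (u (Suc n)) = u n" for n using g(2)[OF uR[of n]] by (simp add: u_def)
  have un: "norm (u n) \<le> C ^ n * norm x" for n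
  proof (induction n)
    case (Suc n)
    have "norm (u (Suc n)) \<le> C * norm (u n)" using g(3)[OF uR[of n]] by (simp add: u_def)
    also have "\<dots> \<le> C * (C ^ n * norm x)" using Suc C(1) by (intro mult_left_mono) auto
    finally show ?case by (simp add: mult.assoc)
  qed (simp add: u0)
  \<comment> \<open>With \<open>t * C = 1/3\<close> the terms after the first sum to at most half the norm of \<open>x\<close>, so that the
    series vanishes only if \<open>x = 0\<close>; any ratio below \<open>1/2\<close> would do.\<close>
  define t where "t = 1 / (3 * C)"
  have t: "t > 0" "t * C = 1/3" using C(1) by (simp_all add: t_def)
  let ?v = "\<lambda>n. t ^ n *\<^sub>R u n"
  have vn: "norm (?v n) \<le> norm x * (1/3) ^ n" for n
  proof -
    have "norm (?v n) \<le> t ^ n * (C ^ n * norm x)" using t(1) un[of n] by (simp add: mult_left_mono)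
    also have "\<dots> = norm x * (t * C) ^ n" by (simp add: power_mult_distrib)
    finally show ?thesis by (simp add: t(2))
  qed
  have "(\<lambda>n. (1/3::real) ^ n) sums (1 / (1 - 1/3))" by (rule geometric_sums) simp
  then have "(\<lambda>n. norm x * (1/3) * (1/3) ^ n) sums (norm x * (1/3) * (3/2))"
    by (intro sums_mult) simp
  then have geo: "(\<lambda>n. norm x * (1/3) ^ Suc n) sums (norm x / 2)" by (simp add: mult.assoc)
  have vS: "summable (\<lambda>n. norm (?v (Suc n)))"
    by (rule summable_comparison_test[OF _ sums_summable[OF geo]]) (use vn in \<open>auto simp del: power_Suc\<close>)
  then have summ: "summable ?v" using summable_Suc_iff summable_norm_cancel by blast
  let ?f = "suminf ?v"
  \<comment> \<open>The partial sums are annihilated by a power of \<open>T\<close>, and the quasinilpotent part is closed.\<close>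
  have "?f \<in> quasinilpotent_part T"
  proof (rule closed_sequentially[OF H])
    show "(\<lambda>n. \<Sum>k<n. ?v k) \<longlonglongrightarrow> ?f" using summ by (rule summable_LIMSEQ)
    fix n
    have pow: "linear (T ^^ k)" for k
      using bounded_linear_funpow[OF T.bounded_linear_axioms] by (rule bounded_linear.linear)
    have vanish: "(T ^^ k) (u j) = 0" if "j < k" for j k
      using that
    proof (induction j arbitrary: k)
      case 0
      then obtain k' where "k = Suc k'" by (cases k) auto
      then show ?case using linear_0[OF pow] by (simp add: u0 x funpow_Suc_right del: funpow.simps)
    next
      case (Suc j)
      then obtain k' where "k = Suc k'" "j < k'" by (cases k) auto
      then show ?case using Suc.IH by (simp add: Tu funpow_Suc_right del: funpow.simps)
    qed
    have "(T ^^ k) (\<Sum>j<n. ?v j) = 0" if "k \<ge> n" for k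
      using that vanish by (simp add: linear_sum[OF pow] linear_scale[OF pow])
    then have "\<forall>\<^sub>F k in sequentially. root k (norm ((T ^^ k) (\<Sum>j<n. ?v j))) = 0"
      unfolding eventually_sequentially by (intro exI[of _ n]) auto
    then show "(\<Sum>j<n. ?v j) \<in> quasinilpotent_part T"
      unfolding quasinilpotent_part_def by (auto intro: tendsto_eventually)
  qed
  \<comment> \<open>\<open>T\<close> kills the first term and moves every other one to the preceding index.\<close>
  moreover have "T ?f = complex_of_real t *\<^sub>C ?f"
  proof -
    have "(\<lambda>n. T (?v n)) sums T ?f" by (rule T.sums[OF summable_sums[OF summ]])
    then have "(\<lambda>n. T (?v (Suc n))) sums (T ?f - T (?v 0))" by (subst sums_Suc_iff) simp
    then have "(\<lambda>n. t *\<^sub>R ?v n) sums T ?f" by (simp add: T.scaleR Tu u0 x del: funpow.simps)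
    moreover have "(\<lambda>n. t *\<^sub>R ?v n) sums (t *\<^sub>R ?f)"
      by (rule sums_scaleR_right[OF summable_sums[OF summ]])
    ultimately show ?thesis by (simp add: sums_unique2 scaleR_scaleC[symmetric])
  qed
  ultimately have f0: "?f = 0"
    using t(1) by (intro eigenvector_notin_quasinilpotent_part[OF T]) auto
  have "?f = x + (\<Sum>n. ?v (Suc n))" using suminf_split_head[OF summ] by (simp add: u0)
  with f0 have "norm x = norm (\<Sum>n. ?v (Suc n))"
    by (metis add_eq_0_iff norm_minus_cancel)
  also have "\<dots> \<le> (\<Sum>n. norm (?v (Suc n)))" by (rule summable_norm[OF vS])
  also have "\<dots> \<le> (\<Sum>n. norm x * (1/3) ^ Suc n)"
    by (rule suminf_le[OF vn vS sums_summable[OF geo]])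
  also have "\<dots> = norm x / 2" using geo by (simp add: sums_iff)
  finally show "x = 0" by simp
qed

text \<open>
  If every vector of \<open>T ` M\<close> has a preimage of norm at most \<open>C\<close> times its own norm and \<open>T\<close> is injective
  on \<open>M\<close>, then \<open>norm m \<le> C * norm (T m)\<close> for \<open>m \<in> M\<close>. So every eigenvalue on \<open>M\<close> has modulus at
  least \<open>1 / C\<close>.
\<close>

lemma GKD_imp_injective_near_0:
  fixes T :: "'a::complex_banach \<Rightarrow> 'a"
  assumes T: "bounded_clinear T" and "admits_GKD T" and H: "closed (quasinilpotent_part T)"
  obtains e where "e > 0" "\<And>l. l \<noteq> 0 \<Longrightarrow> cmod l < e \<Longrightarrow> inj (shift T l)"
proof -
  interpret T: bounded_linear T using T by (simp add: bounded_clinear_def)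
  have hom: "\<And>c x. T (c *\<^sub>C x) = c *\<^sub>C T x" using T by (simp add: bounded_clinear_def)
  obtain M N where MN: "closed M" "direct_sum_decomp M N" "T ` M \<subseteq> M" "T ` N \<subseteq> N"
      "Kato_on M T" "quasinilpotent_on N T"
    using assms(2) unfolding admits_GKD_def by blast
  have M: "csubspace M" and N: "csubspace N" and MN0: "M \<inter> N = {0}"
    using MN(2) by (auto simp: direct_sum_decomp_def)
  obtain C where C: "C > 0" "\<And>y. y \<in> T ` M \<Longrightarrow> \<exists>z\<in>M. T z = y \<and> norm z \<le> C * norm y"
    using bounded_preimage[OF T.bounded_linear_axioms csubspace_imp_subspace[OF M] MN(1)] MN(5)
    unfolding Kato_on_def by metis
  have bound: "norm m \<le> C * norm (T m)" if m: "m \<in> M" for m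
  proof -
    obtain z where z: "z \<in> M" "T z = T m" "norm z \<le> C * norm (T m)" using C(2) m by blast
    have "m - z = 0"
    proof (rule Kato_closed_quasinilpotent_part_imp_injective[OF T M MN(1,3,5) H])
      show "m - z \<in> M" using M m z(1) by (rule complex_vector.subspace_diff)
      show "T (m - z) = 0" by (simp add: T.diff z(2))
    qed
    with z show ?thesis by simp
  qed
  show ?thesis
  proof (rule that[of "1 / C"])
    show "1 / C > 0" using C(1) by simp
    fix l :: complex assume l: "l \<noteq> 0" "cmod l < 1 / C"
    have "x = 0" if x: "T x = l *\<^sub>C x" for x
    proof -
      obtain m n where mn: "m \<in> M" "n \<in> N" "x = m + n"
        using MN(2) unfolding direct_sum_decomp_def by blast
      have eq: "T m - l *\<^sub>C m = l *\<^sub>C n - T n"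
        using x by (simp add: mn T.add scaleC_add_right algebra_simps)
      have "T m - l *\<^sub>C m \<in> M"
        using mn MN(3) M by (intro complex_vector.subspace_diff complex_vector.subspace_scale) auto
      moreover have "l *\<^sub>C n - T n \<in> N"
        using mn MN(4) N by (intro complex_vector.subspace_diff complex_vector.subspace_scale) auto
      ultimately have "T m - l *\<^sub>C m = 0" using MN0 unfolding eq by blast
      with eq have ev: "T m = l *\<^sub>C m" "T n = l *\<^sub>C n" by simp_all
      have "norm m \<le> (C * cmod l) * norm m" using bound[OF mn(1)] by (simp add: ev norm_scaleC)
      moreover have "C * cmod l < 1" using l C(1) by (simp add: field_simps)
      ultimately have "m = 0"
        by (metis mult_less_cancel_right2 not_less norm_le_zero_iff)
      moreover have "n = 0"
        using eigenvector_notin_quasinilpotent_part[OF T ev(2) _ l(1)] mn(2)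
          quasinilpotent_on_imp_subset_quasinilpotent_part[OF T MN(6)] by blast
      ultimately show "x = 0" by (simp add: mn)
    qed
    note * = this
    show "inj (shift T l)"
    proof (rule injI)
      fix x y assume "T x - l *\<^sub>C x = T y - l *\<^sub>C y"
      then have "T (x - y) = l *\<^sub>C (x - y)"
        by (simp add: T.diff complex_vector.scale_right_diff_distrib algebra_simps)
      then show "x = y" using * by force
    qed
  qed
qed

section \<open>Isolated points of the two spectra\<close>

lemma lw_spectrum_subset_spectrum:
  assumes "bounded_clinear T"
  shows "lw_spectrum T \<subseteq> spectrum T"
  using assms invertible_imp_lower_semi_Weyl bounded_clinear_shift
  by (auto simp: lw_spectrum_def spectrum_def)

theorem corollary2p3:
  fixes T :: "'a::complex_banach \<Rightarrow> 'a"
  assumes "\<not> fin_dim (UNIV :: 'a set)"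
    and "bounded_clinear T"
    and "0 \<in> lw_spectrum T"
    and "admits_GKD T"
    and "closed (quasinilpotent_part T)"
  shows "0 isolated_in lw_spectrum T \<longleftrightarrow> 0 isolated_in spectrum T"
proof
  note sub = lw_spectrum_subset_spectrum[OF assms(2)]
  show "0 isolated_in lw_spectrum T" if "0 isolated_in spectrum T"
    using that assms(3) sub unfolding isolated_in_dist_Ex_iff by blast
  assume "0 isolated_in lw_spectrum T"
  then obtain d where d: "d > 0" "\<And>l. l \<in> lw_spectrum T \<Longrightarrow> dist 0 l < d \<Longrightarrow> l = 0"
    unfolding isolated_in_dist_Ex_iff by metis
  obtain e where e: "e > 0" "\<And>l. l \<noteq> 0 \<Longrightarrow> cmod l < e \<Longrightarrow> inj (shift T l)"
    using GKD_imp_injective_near_0[OF assms(2,4,5)] by metis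
  have "l = 0" if l: "l \<in> spectrum T" "dist 0 l < min d e" for l
  proof (rule ccontr)
    assume "l \<noteq> 0"
    then have "inj (shift T l)" "lower_semi_Weyl (shift T l)"
      using l(2) d(2) e(2) by (auto simp: lw_spectrum_def)
    then have "bij (shift T l)"
      using injective_lower_semi_Weyl_imp_surj[OF bounded_clinear_shift[OF assms(2)]]
      by (simp add: bij_def)
    then have "invertible_op (shift T l)"
      by (rule bij_bounded_clinear_imp_invertible[OF bounded_clinear_shift[OF assms(2)]])
    with l(1) show False by (simp add: spectrum_def)
  qed
  with d(1) e(1) sub assms(3) show "0 isolated_in spectrum T"
    unfolding isolated_in_dist_Ex_iff by (metis min_less_iff_conj subsetD)
qed

end
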